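(* Let $X$ be a geodesic metric space and let $Y$ and $Y'$ be $\mu$-Morse subspaces of $X$. Let $\epsilon\ge 0$ be a constant such that the image of $\pi_Y^\epsilon$ does not contain the empty set, and such that there exist points $p\in Y$ and $p'\in Y'$ such that $d(p,p')\le d(Y,Y')+\epsilon$. Suppose $d(Y,Y')>2\mu(6,0)$. Then there is a sublinear function $\rho$ depending only on $\mu$ such that $\operatorname{diam}\pi_Y^\epsilon(Y')\le\rho(d(Y,Y'))$.
   Context: For $L\ge 1$, $A\ge 0$, an $(L,A)$-quasi-geodesic is a (not necessarily continuous) map $\gamma$ from an interval to $X$ with $\frac1L|s-t|-A\le d(\gamma(s),\gamma(t))\le L|s-t|+A$ for all $s,t$. A subspace $Y\subset X$ is $\mu$-Morse, for a function $\mu\colon[1,\infty)\times[0,\infty)\to[0,\infty)$, if for all $L\ge1$, $A\ge0$, every $(L,A)$-quasi-geodesic with endpoints on $Y$ remains within distance $\mu(L,A)$ of $Y$. The $\epsilon$-closest point projection is $\pi_Y^\epsilon\colon X\to 2^Y$, $\pi^\epsilon_Y(x)=\{y\in Y\mid d(x,y)\le d(x,Y)+\epsilon\}$; for $Z\subset X$, $\pi_Y^\epsilon(Z)=\bigcup_{z\in Z}\pi_Y^\epsilon(z)$. $d(Y,Y')=\inf\{d(y,y')\mid y\in Y,y'\in Y'\}$. A function $f\colon[0,\infty)\to\mathbb{R}$ is sublinear if it is non-decreasing, eventually non-negative, and $\lim_{r\to\infty}f(r)/r=0$.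
   Formalization: The sublinear function depends on μ and on the constant ε, not on μ alone (projecting the end of a segment glued to a line gives diameter 2ε at fixed distance, so ε cannot be dropped); it is uniform over all X, Y, Y' with points in a given, arbitrary carrier type. *)

theory Defs
  imports "HOL-Analysis.Analysis"
begin

definition geodesic_space :: "'a metric \<Rightarrow> bool" where
  "geodesic_space X \<longleftrightarrow>
     (\<forall>x\<in>mspace X. \<forall>y\<in>mspace X. \<exists>\<gamma>::real \<Rightarrow> 'a.
        \<gamma> ` {0..mdist X x y} \<subseteq> mspace X \<and>
        \<gamma> 0 = x \<and> \<gamma> (mdist X x y) = y \<and>
        (\<forall>s\<in>{0..mdist X x y}. \<forall>t\<in>{0..mdist X x y}. mdist X (\<gamma> s) (\<gamma> t) = \<bar>s - t\<bar>))"

text \<open>Continuity is not required.\<close>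

definition quasi_geodesic :: "'a metric \<Rightarrow> real \<Rightarrow> real \<Rightarrow> real set \<Rightarrow> (real \<Rightarrow> 'a) \<Rightarrow> bool" where
  "quasi_geodesic X L A I \<gamma> \<longleftrightarrow>
     is_interval I \<and> \<gamma> ` I \<subseteq> mspace X \<and>
     (\<forall>s\<in>I. \<forall>t\<in>I. 1 / L * \<bar>s - t\<bar> - A \<le> mdist X (\<gamma> s) (\<gamma> t) \<and>
                 mdist X (\<gamma> s) (\<gamma> t) \<le> L * \<bar>s - t\<bar> + A)"

text \<open>The following two infima are only meaningful for nonempty sets.\<close>

definition point_set_dist :: "'a metric \<Rightarrow> 'a \<Rightarrow> 'a set \<Rightarrow> real" where
  "point_set_dist X x Y = Inf {mdist X x y | y. y \<in> Y}"

definition set_set_dist :: "'a metric \<Rightarrow> 'a set \<Rightarrow> 'a set \<Rightarrow> real" where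
  "set_set_dist X Y Y' = Inf {mdist X y y' | y y'. y \<in> Y \<and> y' \<in> Y'}"

text \<open>A quasi-geodesic with endpoints is one whose domain is a compact interval.\<close>

definition Morse_subspace :: "'a metric \<Rightarrow> (real \<Rightarrow> real \<Rightarrow> real) \<Rightarrow> 'a set \<Rightarrow> bool" where
  "Morse_subspace X \<mu> Y \<longleftrightarrow>
     Y \<subseteq> mspace X \<and>
     (\<forall>L\<ge>1. \<forall>A\<ge>0. \<forall>a b \<gamma>.
        a \<le> b \<longrightarrow> quasi_geodesic X L A {a..b} \<gamma> \<longrightarrow> \<gamma> a \<in> Y \<longrightarrow> \<gamma> b \<in> Y \<longrightarrow>
        (\<forall>t\<in>{a..b}. point_set_dist X (\<gamma> t) Y \<le> \<mu> L A))"

definition closest_proj :: "'a metric \<Rightarrow> real \<Rightarrow> 'a set \<Rightarrow> 'a \<Rightarrow> 'a set" where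
  "closest_proj X \<epsilon> Y x = {y \<in> Y. mdist X x y \<le> point_set_dist X x Y + \<epsilon>}"

definition closest_proj_set :: "'a metric \<Rightarrow> real \<Rightarrow> 'a set \<Rightarrow> 'a set \<Rightarrow> 'a set" where
  "closest_proj_set X \<epsilon> Y Z = (\<Union>z\<in>Z. closest_proj X \<epsilon> Y z)"

text \<open>The diameter is extended-real valued, so that a real upper bound on it entails boundedness
  (a real-valued supremum would be arbitrary on unbounded sets).\<close>

definition mdiam :: "'a metric \<Rightarrow> 'a set \<Rightarrow> ereal" where
  "mdiam X S = (SUP x\<in>S. SUP y\<in>S. ereal (mdist X x y))"

text \<open>Functions on $[0,\infty)$ are represented by total functions whose values at negative
  arguments are irrelevant.\<close>

definition sublinear :: "(real \<Rightarrow> real) \<Rightarrow> bool" where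
  "sublinear f \<longleftrightarrow>
     mono_on {0..} f \<and> (\<forall>\<^sub>F r in at_top. 0 \<le> f r) \<and> ((\<lambda>r. f r / r) \<longlongrightarrow> 0) at_top"

end

(* Let R = d(Y,Y'), let x in Y', let y be an eps-closest point of Y to x, and D = d(p,y).
   Walk along geodesics p' -> p -> y -> x. Points u on [p,p'] and v on [y,x] move away from Y at
   unit speed up to eps. If d(u,v) is always at least a fixed fraction of d(u,p) + D + d(y,v), the
   walk is a quasi-geodesic with endpoints on Y' whose constants depend only on mu and eps, so R is
   bounded. Otherwise take such a close pair (u,v) with d(u,p) + d(v,y) minimal. If D >= delta R,
   the walk p -> u -> v -> y is a (60/delta,0)-quasi-geodesic with endpoints on Y, so u is
   boundedly close to Y and D is bounded in terms of delta; hence D <= delta R + M(delta) for every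
   delta, and the infimum over delta of the right-hand sides is sublinear.

   For bounded R > 2 mu(6,0) the additive constants have to be removed: rounding the corners of the
   walk by shortest connections between its sides turns it into a (6,0)-quasi-geodesic as soon as D
   exceeds a linear function of R. A point of the middle side is then within mu(6,0) of both Y and
   Y', which is absurd. *)

theory Submission imports Defs begin

section \<open>Distances from points to sets and between sets\<close>

lemma point_set_dist_le:
  assumes "y \<in> Y"
  shows "point_set_dist X x Y \<le> mdist X x y"
  unfolding point_set_dist_def
  using assms by (intro cInf_lower bdd_belowI[of _ 0]) auto

lemma point_set_dist_greatest:
  assumes "Y \<noteq> {}" "\<And>y. y \<in> Y \<Longrightarrow> c \<le> mdist X x y"
  shows "c \<le> point_set_dist X x Y"
  unfolding point_set_dist_def using assms by (intro cInf_greatest) auto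

lemma set_set_dist_le:
  assumes "y \<in> Y" "y' \<in> Y'"
  shows "set_set_dist X Y Y' \<le> mdist X y y'"
  unfolding set_set_dist_def
  using assms by (intro cInf_lower bdd_belowI[of _ 0]) auto

lemma set_set_dist_nonneg:
  assumes "y \<in> Y" "y' \<in> Y'"
  shows "0 \<le> set_set_dist X Y Y'"
  unfolding set_set_dist_def using assms by (intro cInf_greatest) auto

lemma set_set_dist_le_point:
  assumes "y \<in> Y" "Y' \<noteq> {}"
  shows "set_set_dist X Y Y' \<le> point_set_dist X y Y'"
  using assms by (intro point_set_dist_greatest) (auto intro: set_set_dist_le)

lemma point_set_dist_triangle:
  assumes "Y \<noteq> {}" "Y \<subseteq> mspace X" "u \<in> mspace X" "v \<in> mspace X"
  shows "point_set_dist X u Y \<le> mdist X u v + point_set_dist X v Y"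
proof -
  have "point_set_dist X u Y - mdist X u v \<le> point_set_dist X v Y"
  proof (rule point_set_dist_greatest)
    fix y assume "y \<in> Y"
    then show "point_set_dist X u Y - mdist X u v \<le> mdist X v y"
      using point_set_dist_le[of y Y X u] mdist_triangle[of u X v y] assms by auto
  qed fact
  then show ?thesis by simp
qed

text \<open>Source of the contradiction in \<open>rough_bound\<close>: a point within
  \<open>m\<close> of both subspaces forces their distance to be at most
  \<open>2 * m\<close>.\<close>

lemma set_set_dist_le_via:
  assumes "Y \<noteq> {}" "Y' \<noteq> {}" "Y \<subseteq> mspace X" "Y' \<subseteq> mspace X" "z \<in> mspace X"
  shows "set_set_dist X Y Y' \<le> point_set_dist X z Y + point_set_dist X z Y'"
proof -
  have "set_set_dist X Y Y' - point_set_dist X z Y' \<le> point_set_dist X z Y"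
  proof (rule point_set_dist_greatest)
    fix y assume y: "y \<in> Y"
    show "set_set_dist X Y Y' - point_set_dist X z Y' \<le> mdist X z y"
      using set_set_dist_le_point[OF y assms(2), of X] point_set_dist_triangle[of Y' X y z] y assms
        mdist_commute[of X y z]
      by auto
  qed fact
  then show ?thesis by simp
qed

section \<open>One-Lipschitz quasi-geodesics and their concatenation\<close>

text \<open>The upper bound is 1-Lipschitz whatever \<open>L\<close> and \<open>A\<close> are, so that it is inherited by
  concatenations and only lower bounds need to be checked there.\<close>

definition qpath :: "'a metric \<Rightarrow> real \<Rightarrow> real \<Rightarrow> real \<Rightarrow> (real \<Rightarrow> 'a) \<Rightarrow> bool" where
  "qpath X L A l \<gamma> \<longleftrightarrow> 0 \<le> l \<and> \<gamma> ` {0..l} \<subseteq> mspace X \<and>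
     (\<forall>s t. 0 \<le> s \<and> s \<le> t \<and> t \<le> l \<longrightarrow>
        (t - s) / L - A \<le> mdist X (\<gamma> s) (\<gamma> t) \<and> mdist X (\<gamma> s) (\<gamma> t) \<le> t - s)"

definition join :: "real \<Rightarrow> (real \<Rightarrow> 'a) \<Rightarrow> (real \<Rightarrow> 'a) \<Rightarrow> real \<Rightarrow> 'a" where
  "join k \<gamma> \<delta> t = (if t \<le> k then \<gamma> t else \<delta> (t - k))"

abbreviation geod :: "'a metric \<Rightarrow> real \<Rightarrow> (real \<Rightarrow> 'a) \<Rightarrow> bool" where
  "geod X \<equiv> qpath X 1 0"

lemma qpath_nonneg: "qpath X L A l \<gamma> \<Longrightarrow> 0 \<le> l"
  by (simp add: qpath_def)

lemma qpath_mspace: "qpath X L A l \<gamma> \<Longrightarrow> 0 \<le> t \<Longrightarrow> t \<le> l \<Longrightarrow> \<gamma> t \<in> mspace X"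
  by (auto simp: qpath_def)

lemma geod_mdist:
  assumes "geod X l \<gamma>" "0 \<le> s" "s \<le> l" "0 \<le> t" "t \<le> l"
  shows "mdist X (\<gamma> s) (\<gamma> t) = \<bar>s - t\<bar>"
proof (cases "s \<le> t")
  case True
  then have "(t - s) / 1 - 0 \<le> mdist X (\<gamma> s) (\<gamma> t) \<and> mdist X (\<gamma> s) (\<gamma> t) \<le> t - s"
    using assms unfolding qpath_def by blast
  then show ?thesis using True by simp
next
  case False
  then have "(s - t) / 1 - 0 \<le> mdist X (\<gamma> t) (\<gamma> s) \<and> mdist X (\<gamma> t) (\<gamma> s) \<le> s - t"
    using assms unfolding qpath_def by (meson nle_le)
  then show ?thesis using False mdist_commute[of X "\<gamma> s" "\<gamma> t"] by simp
qed

lemma geodI: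
  assumes "0 \<le> l" "\<And>t. 0 \<le> t \<Longrightarrow> t \<le> l \<Longrightarrow> \<gamma> t \<in> mspace X"
    "\<And>s t. 0 \<le> s \<Longrightarrow> s \<le> t \<Longrightarrow> t \<le> l \<Longrightarrow> mdist X (\<gamma> s) (\<gamma> t) = t - s"
  shows "geod X l \<gamma>"
  using assms unfolding qpath_def by auto

lemma geod_mono:
  assumes "geod X l \<gamma>" "1 \<le> L" "0 \<le> A"
  shows "qpath X L A l \<gamma>"
proof -
  have "(t - s) / L - A \<le> mdist X (\<gamma> s) (\<gamma> t) \<and> mdist X (\<gamma> s) (\<gamma> t) \<le> t - s"
    if st: "0 \<le> s" "s \<le> t" "t \<le> l" for s t
  proof -
    have "mdist X (\<gamma> s) (\<gamma> t) = t - s" using geod_mdist[OF assms(1), of s t] st by auto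
    moreover have "(t - s) / L \<le> t - s"
      using st assms(2) by (simp add: divide_le_eq mult_le_cancel_left1)
    ultimately show ?thesis using assms(3) by linarith
  qed
  then show ?thesis using assms(1) unfolding qpath_def by blast
qed

lemma geod_sub:
  assumes "geod X l \<gamma>" "0 \<le> a" "a \<le> b" "b \<le> l"
  shows "geod X (b - a) (\<lambda>t. \<gamma> (a + t))"
proof (rule geodI)
  show "\<gamma> (a + t) \<in> mspace X" if "0 \<le> t" "t \<le> b - a" for t
    using qpath_mspace[OF assms(1), of "a + t"] that assms by simp
  show "mdist X (\<gamma> (a + s)) (\<gamma> (a + t)) = t - s" if "0 \<le> s" "s \<le> t" "t \<le> b - a" for s t
    using geod_mdist[OF assms(1), of "a + s" "a + t"] that assms by simp
qed (use assms in simp)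

lemma geod_reverse:
  assumes "geod X l \<gamma>"
  shows "geod X l (\<lambda>t. \<gamma> (l - t))"
proof (rule geodI)
  show "\<gamma> (l - t) \<in> mspace X" if "0 \<le> t" "t \<le> l" for t
    using qpath_mspace[OF assms, of "l - t"] that by simp
  show "mdist X (\<gamma> (l - s)) (\<gamma> (l - t)) = t - s" if "0 \<le> s" "s \<le> t" "t \<le> l" for s t
    using geod_mdist[OF assms, of "l - s" "l - t"] that by simp
qed (use qpath_nonneg[OF assms] in simp)

lemma geodesic_space_geod:
  assumes "geodesic_space X" "x \<in> mspace X" "y \<in> mspace X"
  obtains \<gamma> where "geod X (mdist X x y) \<gamma>" "\<gamma> 0 = x" "\<gamma> (mdist X x y) = y"
proof -
  obtain \<gamma> where \<gamma>: "\<gamma> ` {0..mdist X x y} \<subseteq> mspace X" "\<gamma> 0 = x" "\<gamma> (mdist X x y) = y"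
    "\<forall>s\<in>{0..mdist X x y}. \<forall>t\<in>{0..mdist X x y}. mdist X (\<gamma> s) (\<gamma> t) = \<bar>s - t\<bar>"
    using assms unfolding geodesic_space_def by blast
  show thesis
  proof (rule that)
    show "geod X (mdist X x y) \<gamma>"
      by (rule geodI) (use \<gamma> in auto)
  qed fact+
qed

text \<open>Pairs on one side inherit both bounds. For a pair straddling the joint, the triangle
  inequality through the common point gives the upper bound, so \<open>cross\<close> asks for the
  lower one only.\<close>

lemma qpath_join:
  assumes \<gamma>: "qpath X L A k \<gamma>" and \<delta>: "qpath X L A l \<delta>" and eq: "\<gamma> k = \<delta> 0"
    and cross: "\<And>s t. 0 \<le> s \<Longrightarrow> s \<le> k \<Longrightarrow> 0 \<le> t \<Longrightarrow> t \<le> l \<Longrightarrow>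
      (k - s + t) / L - A \<le> mdist X (\<gamma> s) (\<delta> t)"
  shows "qpath X L A (k + l) (join k \<gamma> \<delta>)"
  unfolding qpath_def
proof (intro conjI allI impI)
  note k = qpath_nonneg[OF \<gamma>] and l = qpath_nonneg[OF \<delta>]
  show "0 \<le> k + l" using k l by simp
  show "join k \<gamma> \<delta> ` {0..k + l} \<subseteq> mspace X"
    using qpath_mspace[OF \<gamma>] qpath_mspace[OF \<delta>] by (auto simp: join_def)
  fix s t assume st: "0 \<le> s \<and> s \<le> t \<and> t \<le> k + l"
  let ?d = "mdist X (join k \<gamma> \<delta> s) (join k \<gamma> \<delta> t)"
  consider "t \<le> k" | "s \<le> k" "k < t" | "k < s" by linarith
  then have "(t - s) / L - A \<le> ?d \<and> ?d \<le> t - s"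
  proof cases
    case 1
    then show ?thesis using \<gamma> st unfolding qpath_def join_def by auto
  next
    case 2
    have d: "?d = mdist X (\<gamma> s) (\<delta> (t - k))" using 2 by (simp add: join_def)
    have "(k - s + (t - k)) / L - A \<le> ?d" unfolding d by (rule cross) (use 2 st in auto)
    moreover have "mdist X (\<gamma> s) (\<gamma> k) \<le> k - s" using \<gamma> 2 st unfolding qpath_def by blast
    moreover have "mdist X (\<delta> 0) (\<delta> (t - k)) \<le> (t - k) - 0"
      using \<delta> 2 st unfolding qpath_def by (smt (verit))
    moreover have "?d \<le> mdist X (\<gamma> s) (\<gamma> k) + mdist X (\<gamma> k) (\<delta> (t - k))"
      unfolding d using 2 st k
      by (intro mdist_triangle) (auto intro!: qpath_mspace[OF \<gamma>] qpath_mspace[OF \<delta>])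
    ultimately show ?thesis using eq by simp
  next
    case 3
    have "((t - k) - (s - k)) / L - A \<le> mdist X (\<delta> (s - k)) (\<delta> (t - k)) \<and>
          mdist X (\<delta> (s - k)) (\<delta> (t - k)) \<le> (t - k) - (s - k)"
      using \<delta> 3 st unfolding qpath_def by (smt (verit))
    then show ?thesis using 3 st by (simp add: join_def)
  qed
  then show "(t - s) / L - A \<le> ?d" "?d \<le> t - s" by auto
qed

lemma join_start: "0 \<le> k \<Longrightarrow> join k \<gamma> \<delta> 0 = \<gamma> 0"
  by (simp add: join_def)

lemma join_end: "0 \<le> l \<Longrightarrow> \<gamma> k = \<delta> 0 \<Longrightarrow> join k \<gamma> \<delta> (k + l) = \<delta> l"
  by (simp add: join_def)

text \<open>Since \<open>1 \<le> L\<close> and \<open>0 \<le> A\<close>, being 1-Lipschitz is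
  stronger than the upper bound in \<open>quasi_geodesic\<close>; symmetry of the metric removes the
  ordering \<open>s \<le> t\<close>.\<close>

lemma Morse_qpath:
  assumes "Morse_subspace X \<mu> Y" "qpath X L A l \<gamma>" "1 \<le> L" "0 \<le> A" "\<gamma> 0 \<in> Y" "\<gamma> l \<in> Y"
    "0 \<le> t" "t \<le> l"
  shows "point_set_dist X (\<gamma> t) Y \<le> \<mu> L A"
proof -
  have "quasi_geodesic X L A {0..l} \<gamma>"
    unfolding quasi_geodesic_def
  proof (intro conjI ballI)
    show "\<gamma> ` {0..l} \<subseteq> mspace X" using assms(2) by (simp add: qpath_def)
    fix s t assume st: "s \<in> {0..l}" "t \<in> {0..l}"
    have le: "(t - s) / L - A \<le> mdist X (\<gamma> s) (\<gamma> t) \<and> mdist X (\<gamma> s) (\<gamma> t) \<le> t - s"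
      if "s \<in> {0..l}" "t \<in> {0..l}" "s \<le> t" for s t
      using assms(2) that unfolding qpath_def by auto
    have *: "\<bar>s - t\<bar> / L - A \<le> mdist X (\<gamma> s) (\<gamma> t) \<and> mdist X (\<gamma> s) (\<gamma> t) \<le> \<bar>s - t\<bar>"
      using le[of s t] le[of t s] st mdist_commute[of X "\<gamma> s" "\<gamma> t"]
      by (cases "s \<le> t"; cases "s = t") (simp_all add: abs_if)
    have "\<bar>s - t\<bar> \<le> L * \<bar>s - t\<bar>" using assms(3) by (simp add: mult_le_cancel_right1)
    with * assms(4) show "1 / L * \<bar>s - t\<bar> - A \<le> mdist X (\<gamma> s) (\<gamma> t)"
      "mdist X (\<gamma> s) (\<gamma> t) \<le> L * \<bar>s - t\<bar> + A" by auto
  qed (rule is_interval_cc)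
  moreover have "0 \<le> l" using assms(2) by (simp add: qpath_def)
  ultimately show ?thesis
    using assms unfolding Morse_subspace_def by (metis atLeastAtMost_iff)
qed

section \<open>Nearest points on geodesics and almost closest projections\<close>

text \<open>Both points move at unit speed, so the distance is 2-Lipschitz in the pair of
  parameters. This makes minima over parameter rectangles attained.\<close>

lemma geods_mdist_continuous:
  assumes "geod X k \<gamma>" "geod X l \<delta>"
  shows "continuous_on ({0..k} \<times> {0..l}) (\<lambda>(s, t). mdist X (\<gamma> s) (\<delta> t))"
proof -
  have main: "\<bar>mdist X (\<gamma> s) (\<delta> t) - mdist X (\<gamma> s') (\<delta> t')\<bar> \<le> 2 * dist (s, t) (s', t')"
    if "s \<in> {0..k}" "s' \<in> {0..k}" "t \<in> {0..l}" "t' \<in> {0..l}" for s t s' t'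
  proof -
    have M: "\<gamma> s \<in> mspace X" "\<gamma> s' \<in> mspace X" "\<delta> t \<in> mspace X" "\<delta> t' \<in> mspace X"
      using that qpath_mspace[OF assms(1)] qpath_mspace[OF assms(2)] by auto
    have "mdist X (\<gamma> s) (\<gamma> s') = \<bar>s - s'\<bar>" "mdist X (\<delta> t) (\<delta> t') = \<bar>t - t'\<bar>"
      using that geod_mdist[OF assms(1)] geod_mdist[OF assms(2)] by auto
    moreover have "\<bar>s - s'\<bar> \<le> dist (s, t) (s', t')" "\<bar>t - t'\<bar> \<le> dist (s, t) (s', t')"
      using dist_fst_le[of "(s, t)" "(s', t')"] dist_snd_le[of "(s, t)" "(s', t')"]
      by (auto simp: dist_real_def)
    ultimately show ?thesis
      using mdist_triangle[of "\<gamma> s" X "\<gamma> s'" "\<delta> t"] mdist_triangle[of "\<gamma> s'" X "\<delta> t'" "\<delta> t"]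
        mdist_triangle[of "\<gamma> s'" X "\<gamma> s" "\<delta> t'"] mdist_triangle[of "\<gamma> s" X "\<delta> t" "\<delta> t'"] M
        mdist_commute[of X "\<gamma> s" "\<gamma> s'"] mdist_commute[of X "\<delta> t" "\<delta> t'"]
      by linarith
  qed
  show ?thesis
    unfolding continuous_on_iff
  proof (intro ballI allI impI)
    fix z e assume z: "z \<in> {0..k} \<times> {0..l}" and e: "(0::real) < e"
    show "\<exists>d>0. \<forall>w\<in>{0..k} \<times> {0..l}. dist w z < d \<longrightarrow>
      dist (case w of (s, t) \<Rightarrow> mdist X (\<gamma> s) (\<delta> t)) (case z of (s, t) \<Rightarrow> mdist X (\<gamma> s) (\<delta> t)) < e"
    proof (intro exI[of _ "e / 2"] conjI ballI impI)
      fix w assume w: "w \<in> {0..k} \<times> {0..l}" "dist w z < e / 2"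
      then show "dist (case w of (s, t) \<Rightarrow> mdist X (\<gamma> s) (\<delta> t))
          (case z of (s, t) \<Rightarrow> mdist X (\<gamma> s) (\<delta> t)) < e"
        using main[of "fst w" "fst z" "snd w" "snd z"] z
        by (auto simp: dist_real_def split: prod.splits)
    qed (use e in simp)
  qed
qed

text \<open>Compactness of the parameter rectangle. The cutoff \<open>r\<close> serves
  \<open>rough_bound\<close>, where the second point has to stay away from the start of its
  geodesic.\<close>

lemma closest_pair_of_geods:
  assumes "geod X k \<gamma>" "geod X l \<delta>" "0 \<le> r" "r \<le> l"
  obtains s t where "0 \<le> s" "s \<le> k" "r \<le> t" "t \<le> l"
    "\<And>s' t'. 0 \<le> s' \<Longrightarrow> s' \<le> k \<Longrightarrow> r \<le> t' \<Longrightarrow> t' \<le> l \<Longrightarrow> mdist X (\<gamma> s) (\<delta> t) \<le> mdist X (\<gamma> s') (\<delta> t')"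
proof -
  let ?f = "\<lambda>(s, t). mdist X (\<gamma> s) (\<delta> t)"
  have "0 \<le> k" using assms(1) by (rule qpath_nonneg)
  have "continuous_on ({0..k} \<times> {r..l}) ?f"
    by (rule continuous_on_subset[OF geods_mdist_continuous[OF assms(1,2)]]) (use assms in auto)
  then have "\<exists>z\<in>{0..k} \<times> {r..l}. \<forall>w\<in>{0..k} \<times> {r..l}. ?f z \<le> ?f w"
    using \<open>0 \<le> k\<close> assms by (intro continuous_attains_inf compact_Times) auto
  then show thesis using that by fastforce
qed

lemma closest_on_geod:
  assumes "geod X k \<gamma>" "x \<in> mspace X"
  obtains s where "0 \<le> s" "s \<le> k"
    "\<And>s'. 0 \<le> s' \<Longrightarrow> s' \<le> k \<Longrightarrow> mdist X x (\<gamma> s) \<le> mdist X x (\<gamma> s')"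
proof -
  have "mdist X x x = 0" using assms(2) by simp
  \<comment> \<open>A point is a geodesic of length 0, so the statement about pairs applies.\<close>
  then have "geod X 0 (\<lambda>_. x)" using assms(2) by (intro geodI) (auto simp del: mdist_zero)
  then show thesis
    by (rule closest_pair_of_geods[OF assms(1), of 0 _ 0]) (auto simp: mdist_commute intro: that)
qed

text \<open>If \<open>\<kappa> t\<close> were closer to \<open>Y\<close> than
  \<open>t - \<epsilon>\<close>, then going from \<open>x\<close> through \<open>\<kappa> t\<close>
  would show \<open>x\<close> closer to \<open>Y\<close> than \<open>l - \<epsilon>\<close>,
  although \<open>y\<close> is an almost closest point.\<close>

lemma closest_proj_geod:
  assumes "Y \<subseteq> mspace X" "y \<in> closest_proj X \<epsilon> Y x" "geod X l \<kappa>" "\<kappa> 0 = y" "\<kappa> l = x"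
    "0 \<le> t" "t \<le> l"
  shows "t \<le> point_set_dist X (\<kappa> t) Y + \<epsilon>"
proof -
  have y: "y \<in> Y" "mdist X x y \<le> point_set_dist X x Y + \<epsilon>"
    using assms(2) by (auto simp: closest_proj_def)
  have "mdist X (\<kappa> l) (\<kappa> 0) = l" "mdist X (\<kappa> l) (\<kappa> t) = l - t"
    using geod_mdist[OF assms(3)] assms(6,7) by auto
  moreover have "point_set_dist X (\<kappa> l) Y \<le> mdist X (\<kappa> l) (\<kappa> t) + point_set_dist X (\<kappa> t) Y"
    using y(1) assms by (intro point_set_dist_triangle) (auto intro!: qpath_mspace[OF assms(3)])
  ultimately show ?thesis using y(2) assms(4,5) by simp
qed

section \<open>Two Morse subspaces with one projected point\<close>

text \<open>Only one projected point \<open>y\<close> is considered: bounding its distance to the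
  fixed \<open>p\<close> suffices for the diameter. The assumption \<open>gauge_nonneg\<close>
  renders the codomain of the Morse gauge.\<close>

locale Morse_pair =
  fixes X :: "'a metric" and \<mu> :: "real \<Rightarrow> real \<Rightarrow> real" and \<epsilon> :: real
    and Y Y' :: "'a set" and p p' x y :: 'a
  assumes geodesic: "geodesic_space X"
    and Morse: "Morse_subspace X \<mu> Y" "Morse_subspace X \<mu> Y'"
    and gauge_nonneg: "\<And>L A. 1 \<le> L \<Longrightarrow> 0 \<le> A \<Longrightarrow> 0 \<le> \<mu> L A"
    and eps_nonneg: "0 \<le> \<epsilon>"
    and p: "p \<in> Y" "p' \<in> Y'" "mdist X p p' \<le> set_set_dist X Y Y' + \<epsilon>"
    and x: "x \<in> Y'" "y \<in> closest_proj X \<epsilon> Y x"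
begin

abbreviation "R \<equiv> set_set_dist X Y Y'"
abbreviation "D \<equiv> mdist X p y"
abbreviation "m \<equiv> \<mu> 6 0"
abbreviation "A \<equiv> \<epsilon> + m"

lemma subspaces: "Y \<subseteq> mspace X" "Y' \<subseteq> mspace X" "Y \<noteq> {}" "Y' \<noteq> {}"
  using Morse p by (auto simp: Morse_subspace_def)

lemma y: "y \<in> Y"
  using x by (simp add: closest_proj_def)

lemma points: "p \<in> mspace X" "p' \<in> mspace X" "x \<in> mspace X" "y \<in> mspace X"
  using subspaces p x y by auto

lemma m_nonneg: "0 \<le> m"
  by (rule gauge_nonneg) auto

text \<open>Makes the two sides of the walk alike: \<open>p\<close> is to \<open>p'\<close> what
  \<open>y\<close> is to \<open>x\<close>, so one projection lemma serves both.\<close>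

lemma p_closest: "p \<in> closest_proj X \<epsilon> Y p'"
proof -
  have "R \<le> point_set_dist X p' Y"
    using subspaces p(2) set_set_dist_le[of _ Y p' Y' X]
    by (intro point_set_dist_greatest) (auto simp: mdist_commute)
  then show ?thesis using p mdist_commute[of X p p'] by (simp add: closest_proj_def)
qed

lemma side_far:
  assumes "geod X a \<eta>" "\<eta> 0 = p" "\<eta> a = p'" "0 \<le> t" "t \<le> a"
  shows "t \<le> point_set_dist X (\<eta> t) Y + \<epsilon>"
  using closest_proj_geod[OF subspaces(1) p_closest assms] .

lemma side_far':
  assumes "geod X b \<kappa>" "\<kappa> 0 = y" "\<kappa> b = x" "0 \<le> t" "t \<le> b"
  shows "t \<le> point_set_dist X (\<kappa> t) Y + \<epsilon>"
  using closest_proj_geod[OF subspaces(1) x(2) assms] .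

text \<open>Using the constants \<open>(6, 0)\<close> for a geodesic avoids assuming \<open>\<mu>\<close> to be monotone.\<close>

lemma base_near:
  assumes "geod X l \<alpha>" "\<alpha> 0 \<in> Y" "\<alpha> l \<in> Y" "0 \<le> t" "t \<le> l"
  shows "point_set_dist X (\<alpha> t) Y \<le> m"
  using Morse_qpath[OF Morse(1) geod_mono[OF assms(1), of 6 0] _ _ assms(2-5)] by simp

lemmas pd_triangle = point_set_dist_triangle[OF subspaces(3,1)]

section \<open>A linear bound by a walk with rounded corners\<close>

text \<open>Rounding the corners costs the side from \<open>p\<close> to \<open>y\<close> at most
  \<open>2 * (R + \<epsilon>)\<close> and \<open>5 * A\<close>. The constants 9 and 15 leave it
  \<open>7 * (R + \<epsilon>) + 10 * A\<close>, enough to dominate the short connections.\<close>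

lemma rough_bound:
  assumes R: "2 * m < R"
  shows "D \<le> 9 * (R + \<epsilon>) + 15 * A"
proof (rule ccontr)
  assume "\<not> D \<le> 9 * (R + \<epsilon>) + 15 * A"
  then have big: "9 * (R + \<epsilon>) + 15 * A < D" by simp
  note tri = mdist_triangle[of _ X]
  have A: "0 \<le> A" using m_nonneg eps_nonneg by simp
  obtain \<alpha> where \<alpha>: "geod X D \<alpha>" "\<alpha> 0 = p" "\<alpha> D = y"
    using geodesic_space_geod[OF geodesic points(1,4)] .
  obtain \<kappa> where \<kappa>: "geod X (mdist X y x) \<kappa>" "\<kappa> 0 = y" "\<kappa> (mdist X y x) = x"
    using geodesic_space_geod[OF geodesic points(4,3)] .
  define b where "b = mdist X y x"
  note \<kappa> = \<kappa>[folded b_def]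
  have b: "0 \<le> b" by (simp add: b_def)
  \<comment> \<open>The first \<open>2 * A\<close> of \<open>\<kappa>\<close> are skipped: beyond
    them the distance to the base exceeds the error \<open>A\<close> by at least \<open>A\<close>,
    which absorbs additive constants.\<close>
  define \<tau> where "\<tau> = min (2 * A) b"
  have \<tau>: "0 \<le> \<tau>" "\<tau> \<le> b" "\<tau> \<le> 2 * A" using A b by (auto simp: \<tau>_def)
  obtain c0 where c0: "0 \<le> c0" "c0 \<le> D"
    and c0_min: "\<And>s. 0 \<le> s \<Longrightarrow> s \<le> D \<Longrightarrow> mdist X p' (\<alpha> c0) \<le> mdist X p' (\<alpha> s)"
    using closest_on_geod[OF \<alpha>(1) points(2)] by blast
  obtain c1 w where c1: "0 \<le> c1" "c1 \<le> D" and w: "\<tau> \<le> w" "w \<le> b"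
    and min: "\<And>s t. 0 \<le> s \<Longrightarrow> s \<le> D \<Longrightarrow> \<tau> \<le> t \<Longrightarrow> t \<le> b \<Longrightarrow>
      mdist X (\<alpha> c1) (\<kappa> w) \<le> mdist X (\<alpha> s) (\<kappa> t)"
    using closest_pair_of_geods[OF \<alpha>(1) \<kappa>(1) \<tau>(1,2)] by blast
  have M\<alpha>: "\<alpha> t \<in> mspace X" if "0 \<le> t" "t \<le> D" for t using qpath_mspace[OF \<alpha>(1)] that .
  have M\<kappa>: "\<kappa> t \<in> mspace X" if "0 \<le> t" "t \<le> b" for t using qpath_mspace[OF \<kappa>(1)] that .
  have w0: "0 \<le> w" using w \<tau> by simp
  have Mz: "\<alpha> c0 \<in> mspace X" "\<alpha> c1 \<in> mspace X" "\<kappa> w \<in> mspace X"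
    using M\<alpha> M\<kappa> c0 c1 w w0 by auto
  define f0 where "f0 = mdist X p' (\<alpha> c0)"
  define k where "k = mdist X (\<alpha> c1) (\<kappa> w)"
  obtain \<sigma> where \<sigma>: "geod X f0 \<sigma>" "\<sigma> 0 = p'" "\<sigma> f0 = \<alpha> c0"
    using geodesic_space_geod[OF geodesic points(2) Mz(1)] unfolding f0_def .
  obtain \<omega> where \<omega>: "geod X k \<omega>" "\<omega> 0 = \<alpha> c1" "\<omega> k = \<kappa> w"
    using geodesic_space_geod[OF geodesic Mz(2,3)] unfolding k_def .
  have M\<sigma>: "\<sigma> t \<in> mspace X" if "0 \<le> t" "t \<le> f0" for t using qpath_mspace[OF \<sigma>(1)] that .
  have M\<omega>: "\<omega> t \<in> mspace X" if "0 \<le> t" "t \<le> k" for t using qpath_mspace[OF \<omega>(1)] that .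
  have near: "point_set_dist X (\<alpha> t) Y \<le> m" if "0 \<le> t" "t \<le> D" for t
    using base_near[OF \<alpha>(1)] \<alpha> p y that by simp
  have far: "t \<le> point_set_dist X (\<kappa> t) Y + \<epsilon>" if "0 \<le> t" "t \<le> b" for t
    using side_far'[OF \<kappa>] that .
  \<comment> \<open>The competitor is \<open>p\<close>, the start of
    \<open>\<alpha>\<close>.\<close>
  have f0: "0 \<le> f0" "f0 \<le> R + \<epsilon>"
    using c0_min[of 0] \<alpha> p mdist_commute[of X p p'] by (auto simp: f0_def)
  have k: "0 \<le> k" by (simp add: k_def)
  have "c0 \<le> mdist X p p' + f0"
    using tri[of p p' "\<alpha> c0"] points Mz geod_mdist[OF \<alpha>(1), of 0 c0] c0 \<alpha> by (simp add: f0_def)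
  then have c0_le: "c0 \<le> 2 * (R + \<epsilon>)" using p(3) f0 by simp
  \<comment> \<open>The competitor is the pair of \<open>y\<close> and
    \<open>\<kappa> \<tau>\<close>.\<close>
  have k_le: "k \<le> \<tau>"
    using min[of D \<tau>] \<tau> \<alpha> geod_mdist[OF \<kappa>(1), of 0 \<tau>] \<kappa> b by (simp add: k_def)
  have w_le: "w \<le> k + A"
    using far[OF w0 w(2)] near[OF c1] pd_triangle[of "\<kappa> w" "\<alpha> c1"] Mz
      mdist_commute[of X "\<alpha> c1" "\<kappa> w"] by (simp add: k_def)
  have "D - c1 \<le> k + w"
    using tri[of "\<alpha> c1" "\<kappa> w" y] Mz points geod_mdist[OF \<alpha>(1), of c1 D] c1 \<alpha>
      geod_mdist[OF \<kappa>(1), of w 0] \<kappa> w0 w(2) b by (simp add: k_def)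
  moreover define c where "c = c1 - c0"
  ultimately have c: "7 * (R + \<epsilon>) + 10 * A \<le> c" using big c0_le k_le w_le \<tau> by simp
  then have c_nonneg: "0 \<le> c" proof -
    have "0 \<le> R + \<epsilon>" using f0 by linarith
    with c A show ?thesis by argo
  qed

  let ?\<alpha> = "\<lambda>t. \<alpha> (c0 + t)" and ?\<kappa> = "\<lambda>t. \<kappa> (w + t)"
  have g: "qpath X 6 0 f0 \<sigma>" "qpath X 6 0 c ?\<alpha>" "qpath X 6 0 k \<omega>" "qpath X 6 0 (b - w) ?\<kappa>"
    using geod_sub[OF \<alpha>(1) c0(1), of c1] geod_sub[OF \<kappa>(1) w0 w(2)] c_nonneg c1 \<sigma>(1) \<omega>(1)
    by (auto intro!: geod_mono simp: c_def)
  have c01: "c0 + c = c1" by (simp add: c_def)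
  \<comment> \<open>Adjacent sides: minimality of the connection bounds the distance
    \<open>d\<close> below by the part \<open>f0 - s\<close> of it still to walk, and the triangle
    inequality gives \<open>t \<le> (f0 - s) + d\<close>. So the walked length is at most
    \<open>3 * d\<close>. \<open>c23\<close> and \<open>c34\<close> work alike.\<close>
  have c12: "(f0 - s + t) / 6 - 0 \<le> mdist X (\<sigma> s) (?\<alpha> t)"
    if "0 \<le> s" "s \<le> f0" "0 \<le> t" "t \<le> c" for s t
  proof -
    have r: "0 \<le> c0 + t" "c0 + t \<le> D" using that c0 c1 c01 by auto
    show ?thesis
      using c0_min[OF r] tri[of p' "\<sigma> s" "\<alpha> (c0 + t)"] tri[of "\<alpha> c0" "\<sigma> s" "\<alpha> (c0 + t)"]
        geod_mdist[OF \<sigma>(1), of 0 s] geod_mdist[OF \<sigma>(1), of f0 s] \<sigma>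
        geod_mdist[OF \<alpha>(1) c0 r] M\<alpha>[OF r] M\<sigma>[of s] Mz points that f0
      by (simp add: f0_def[symmetric])
  qed
  have c23: "(c - s + t) / 6 - 0 \<le> mdist X (?\<alpha> s) (\<omega> t)"
    if "0 \<le> s" "s \<le> c" "0 \<le> t" "t \<le> k" for s t
  proof -
    have r: "0 \<le> c0 + s" "c0 + s \<le> D" using that c0 c1 c01 by auto
    show ?thesis
      using min[OF r w] tri[of "\<alpha> (c0 + s)" "\<omega> t" "\<kappa> w"] tri[of "\<alpha> (c0 + s)" "\<omega> t" "\<alpha> c1"]
        geod_mdist[OF \<omega>(1), of t k] geod_mdist[OF \<omega>(1), of t 0] \<omega>
        geod_mdist[OF \<alpha>(1) r c1] M\<alpha>[OF r] M\<omega>[of t] Mz that k c01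
      by (simp add: k_def[symmetric])
  qed
  have c34: "(k - s + t) / 6 - 0 \<le> mdist X (\<omega> s) (?\<kappa> t)"
    if "0 \<le> s" "s \<le> k" "0 \<le> t" "t \<le> b - w" for s t
  proof -
    have r: "\<tau> \<le> w + t" "w + t \<le> b" "0 \<le> w + t" using that w w0 by auto
    show ?thesis
      using min[OF c1 r(1,2)] tri[of "\<alpha> c1" "\<omega> s" "\<kappa> (w + t)"] tri[of "\<kappa> w" "\<omega> s" "\<kappa> (w + t)"]
        geod_mdist[OF \<omega>(1), of 0 s] geod_mdist[OF \<omega>(1), of k s] \<omega>
        geod_mdist[OF \<kappa>(1) w0 w(2) r(3,2)] M\<kappa>[OF r(3,2)] M\<omega>[of s] Mz that k
      by (simp add: k_def[symmetric])
  qed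
  \<comment> \<open>Both connections are short, of length at most \<open>R + \<epsilon>\<close> and
    \<open>2 * A\<close>, so \<open>c\<close> dominates.\<close>
  have c13: "(f0 - s + c + t) / 6 \<le> mdist X (\<sigma> s) (\<omega> t)"
    if "0 \<le> s" "s \<le> f0" "0 \<le> t" "t \<le> k" for s t
  proof -
    have "c \<le> (f0 - s) + mdist X (\<sigma> s) (\<omega> t) + t"
      using tri[of "\<alpha> c0" "\<sigma> s" "\<alpha> c1"] tri[of "\<sigma> s" "\<omega> t" "\<alpha> c1"]
        geod_mdist[OF \<sigma>(1), of f0 s] \<sigma> geod_mdist[OF \<omega>(1), of t 0] \<omega>
        geod_mdist[OF \<alpha>(1) c0 c1] M\<sigma>[of s] M\<omega>[of t] Mz that k c01 c_nonneg f0
      by simp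
    then show ?thesis using c that f0 k_le \<tau> A by argo
  qed
  \<comment> \<open>Here \<open>t\<close> is unbounded, and the triangle inequality through the
    middle side is not enough. Since \<open>\<kappa>\<close> moves away from \<open>Y\<close>, a
    large \<open>t\<close> itself forces a large distance.\<close>
  have c14: "(f0 - s + c + k + t) / 6 \<le> mdist X (\<sigma> s) (?\<kappa> t)"
    if "0 \<le> s" "s \<le> f0" "0 \<le> t" "t \<le> b - w" for s t
  proof -
    have r: "w + t \<le> b" "0 \<le> w + t" using that w w0 by auto
    have "c \<le> (f0 - s) + mdist X (\<sigma> s) (\<kappa> (w + t)) + t + k"
      using tri[of "\<alpha> c0" "\<sigma> s" "\<alpha> c1"] tri[of "\<sigma> s" "\<kappa> (w + t)" "\<alpha> c1"]
        tri[of "\<kappa> (w + t)" "\<kappa> w" "\<alpha> c1"]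
        geod_mdist[OF \<sigma>(1), of f0 s] \<sigma> mdist_commute[of X "\<kappa> w" "\<alpha> c1"]
        geod_mdist[OF \<kappa>(1) r(2,1) w0 w(2)] M\<kappa>[OF r(2,1)]
        geod_mdist[OF \<alpha>(1) c0 c1] M\<sigma>[of s] Mz that k c01 c_nonneg f0
      by (simp add: k_def[symmetric])
    moreover have "w + t - \<epsilon> \<le> mdist X (\<sigma> s) (\<kappa> (w + t)) + (f0 - s) + m"
      using far[OF r(2,1)] near[OF c0] pd_triangle[of "\<kappa> (w + t)" "\<sigma> s"]
        pd_triangle[of "\<sigma> s" "\<alpha> c0"] geod_mdist[OF \<sigma>(1), of s f0] \<sigma>
        mdist_commute[of X "\<sigma> s" "\<kappa> (w + t)"] M\<kappa>[OF r(2,1)] M\<sigma>[of s] Mz that f0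
      by simp
    ultimately show ?thesis using c that f0 k_le \<tau> A w0 by argo
  qed
  have c24: "(c - s + k + t) / 6 \<le> mdist X (?\<alpha> s) (?\<kappa> t)"
    if "0 \<le> s" "s \<le> c" "0 \<le> t" "t \<le> b - w" for s t
  proof (cases "b \<le> 2 * A")
    case True
    \<comment> \<open>The last side is degenerate, so \<open>t = 0\<close> and its only point is the
      end of \<open>\<omega>\<close>.\<close>
    then have "w = b" using w by (simp add: \<tau>_def)
    then show ?thesis using c23[of s k] that \<omega> k by simp
  next
    case False
    then have w2: "2 * A \<le> w" using w by (simp add: \<tau>_def)
    have r: "w + t \<le> b" "0 \<le> w + t" "0 \<le> c0 + s" "c0 + s \<le> D" using that w w0 c0 c1 c01 by auto
    have "c - s \<le> mdist X (\<alpha> (c0 + s)) (\<kappa> (w + t)) + t + k"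
      using tri[of "\<alpha> (c0 + s)" "\<kappa> (w + t)" "\<alpha> c1"]
        tri[of "\<kappa> (w + t)" "\<kappa> w" "\<alpha> c1"] mdist_commute[of X "\<kappa> w" "\<alpha> c1"]
        geod_mdist[OF \<kappa>(1) r(2,1) w0 w(2)] M\<kappa>[OF r(2,1)] M\<alpha>[OF r(3,4)]
        geod_mdist[OF \<alpha>(1) r(3,4) c1] Mz that c01
      by (simp add: k_def[symmetric])
    moreover have "w + t - \<epsilon> \<le> mdist X (\<alpha> (c0 + s)) (\<kappa> (w + t)) + m"
      using far[OF r(2,1)] near[OF r(3,4)] pd_triangle[of "\<kappa> (w + t)" "\<alpha> (c0 + s)"]
        mdist_commute[of X "\<alpha> (c0 + s)" "\<kappa> (w + t)"] M\<kappa>[OF r(2,1)] M\<alpha>[OF r(3,4)]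
      by simp
    \<comment> \<open>With \<open>d\<close> the distance, \<open>w2\<close> gives
      \<open>t + A \<le> d\<close>. Together with \<open>k \<le> 2 * A\<close> the walked length is
      at most \<open>d + 2 * t + 2 * k\<close>, hence at most \<open>5 * d\<close>.\<close>
    ultimately show ?thesis using w2 that k_le \<tau> A by argo
  qed

  let ?l = "join f0 \<sigma> ?\<alpha>" and ?r = "join k \<omega> ?\<kappa>"
  let ?\<gamma> = "join (f0 + c) ?l ?r"
  have bw: "0 \<le> b - w" using w by simp
  have l: "qpath X 6 0 (f0 + c) ?l" by (rule qpath_join[OF g(1,2)]) (use \<sigma> c12 in auto)
  have r: "qpath X 6 0 (k + (b - w)) ?r" by (rule qpath_join[OF g(3,4)]) (use \<omega> c34 in auto)
  have eq: "?l (f0 + c) = ?r 0"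
    using join_end[of c \<sigma> f0 ?\<alpha>] join_start[OF k, of \<omega> ?\<kappa>] c_nonneg \<sigma> \<omega> c01 by simp
  have "qpath X 6 0 (f0 + c + (k + (b - w))) ?\<gamma>"
  proof (rule qpath_join[OF l r eq])
    fix s t assume st: "0 \<le> s" "s \<le> f0 + c" "0 \<le> t" "t \<le> k + (b - w)"
    show "(f0 + c - s + t) / 6 - 0 \<le> mdist X (?l s) (?r t)"
      using c13[of s t] c14[of s "t - k"] c23[of "s - f0" t] c24[of "s - f0" "t - k"] st
      by (auto simp: join_def algebra_simps)
  qed
  moreover have "?\<gamma> 0 = p'"
    using f0 c_nonneg \<sigma> by (simp add: join_def)
  moreover have "?\<gamma> (f0 + c + (k + (b - w))) = x"
    using join_end[of "k + (b - w)" ?l "f0 + c" ?r, OF _ eq] join_end[of "b - w" \<omega> k ?\<kappa>]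
      k bw \<omega> \<kappa> by simp
  moreover have "?\<gamma> f0 = \<alpha> c0" using c_nonneg \<sigma> by (simp add: join_def)
  ultimately have "point_set_dist X (\<alpha> c0) Y' \<le> m"
    using Morse_qpath[OF Morse(2), of 6 0 "f0 + c + (k + (b - w))" ?\<gamma> f0] p x f0 c_nonneg k bw
    by simp
  then show False
    using set_set_dist_le_via[OF subspaces(3,4,1,2) Mz(1)] near[OF c0] R by simp
qed

section \<open>The sublinear bound\<close>

text \<open>Otherwise the walk from \<open>p'\<close> through \<open>p\<close> and \<open>y\<close>
  to \<open>x\<close> is a \<open>(6, A)\<close>-quasi-geodesic with ends on \<open>Y'\<close>, and
  its corner \<open>p\<close> would be within \<open>\<mu> 6 A\<close> of \<open>Y'\<close>. The
  factor 6 is also large enough for the later estimates to absorb the gap of a close pair.\<close>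

lemma close_points_exist:
  assumes \<eta>: "geod X a \<eta>" "\<eta> 0 = p" "\<eta> a = p'" and \<kappa>: "geod X b \<kappa>" "\<kappa> 0 = y" "\<kappa> b = x"
    and R: "\<mu> 6 A < R"
  obtains s t where "0 \<le> s" "s \<le> a" "0 \<le> t" "t \<le> b" "mdist X (\<eta> s) (\<kappa> t) \<le> (s + t + D) / 6"
proof (rule ccontr)
  assume no: "\<not> thesis"
  note close = that
  have apart: "(s + t + D) / 6 \<le> mdist X (\<eta> s) (\<kappa> t)"
    if "0 \<le> s" "s \<le> a" "0 \<le> t" "t \<le> b" for s t
    using no close[of s t] that by linarith
  note tri = mdist_triangle[of _ X]
  have A: "0 \<le> A" using m_nonneg eps_nonneg by simp
  have a: "0 \<le> a" and b: "0 \<le> b" using \<eta> \<kappa> by (auto dest: qpath_nonneg)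
  obtain \<alpha> where \<alpha>: "geod X D \<alpha>" "\<alpha> 0 = p" "\<alpha> D = y"
    using geodesic_space_geod[OF geodesic points(1,4)] .
  have near: "point_set_dist X (\<alpha> t) Y \<le> m" if "0 \<le> t" "t \<le> D" for t
    using base_near[OF \<alpha>(1)] \<alpha> p y that by simp
  let ?\<eta> = "\<lambda>t. \<eta> (a - t)"
  have g: "qpath X 6 A a ?\<eta>" "qpath X 6 A D \<alpha>" "qpath X 6 A b \<kappa>"
    using geod_mono[OF geod_reverse[OF \<eta>(1)], of 6 A] geod_mono[OF \<alpha>(1), of 6 A]
      geod_mono[OF \<kappa>(1), of 6 A] A by auto
  have c12: "(a - s + t) / 6 - A \<le> mdist X (?\<eta> s) (\<alpha> t)"
    if "0 \<le> s" "s \<le> a" "0 \<le> t" "t \<le> D" for s t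
  proof -
    have r: "0 \<le> a - s" "a - s \<le> a" using that by auto
    have M: "\<eta> (a - s) \<in> mspace X" "\<alpha> t \<in> mspace X"
      using qpath_mspace[OF \<eta>(1) r] qpath_mspace[OF \<alpha>(1)] that by auto
    have "t \<le> a - s + mdist X (\<eta> (a - s)) (\<alpha> t)"
      using tri[OF points(1) M] geod_mdist[OF \<alpha>(1), of 0 t]
        geod_mdist[OF \<eta>(1) order_refl a r] \<alpha> \<eta> that by simp
    then show ?thesis
      \<comment> \<open>With \<open>d\<close> the distance, leaving the base at unit speed gives
        \<open>a - s \<le> d + A\<close>, so the walked length is at most
        \<open>3 * d + 2 * A\<close>.\<close>
      using side_far[OF \<eta> r] near[OF that(3,4)] pd_triangle[OF M] that A by argo
  qed
  have c23: "(D - s + t) / 6 - A \<le> mdist X (\<alpha> s) (\<kappa> t)"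
    if "0 \<le> s" "s \<le> D" "0 \<le> t" "t \<le> b" for s t
  proof -
    have M: "\<kappa> t \<in> mspace X" "\<alpha> s \<in> mspace X"
      using qpath_mspace[OF \<kappa>(1)] qpath_mspace[OF \<alpha>(1)] that by auto
    have "D - s \<le> t + mdist X (\<kappa> t) (\<alpha> s)"
      using tri[OF points(4) M] geod_mdist[OF \<alpha>(1), of D s] geod_mdist[OF \<kappa>(1), of 0 t]
        \<alpha> \<kappa> that by simp
    then show ?thesis
      using side_far'[OF \<kappa> that(3,4)] near[OF that(1,2)] pd_triangle[OF M] that A
        mdist_commute[of X "\<alpha> s" "\<kappa> t"] by argo
  qed
  let ?l = "join a ?\<eta> \<alpha>"
  let ?\<gamma> = "join (a + D) ?l \<kappa>"
  have l: "qpath X 6 A (a + D) ?l" by (rule qpath_join[OF g(1,2)]) (use \<eta> \<alpha> c12 in auto)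
  have eq: "?l (a + D) = \<kappa> 0" using join_end[of D ?\<eta> a \<alpha>] \<eta> \<alpha> \<kappa> by simp
  have "qpath X 6 A (a + D + b) ?\<gamma>"
  proof (rule qpath_join[OF l g(3) eq])
    fix s t assume st: "0 \<le> s" "s \<le> a + D" "0 \<le> t" "t \<le> b"
    show "(a + D - s + t) / 6 - A \<le> mdist X (?l s) (\<kappa> t)"
      using apart[of "a - s" t] c23[of "s - a" t] st A by (auto simp: join_def algebra_simps)
  qed
  moreover have "?\<gamma> 0 = p'" using a \<eta> by (simp add: join_def)
  moreover have "?\<gamma> (a + D + b) = x" using join_end[of b ?l "a + D" \<kappa>, OF b eq] \<kappa> by simp
  moreover have "?\<gamma> a = p" using \<eta> by (simp add: join_def)
  ultimately have "point_set_dist X p Y' \<le> \<mu> 6 A"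
    using Morse_qpath[OF Morse(2), of 6 A "a + D + b" ?\<gamma> a] p x a b A by simp
  then show False
    using set_set_dist_le_point[OF p(1) subspaces(4), of X] R by simp
qed

lemma sublinear_bound:
  assumes R: "\<mu> 6 A < R" and \<delta>: "0 < \<delta>" "\<delta> \<le> 1"
  shows "D \<le> \<delta> * R + (5 * \<mu> (60 / \<delta>) 0 + 8 * \<epsilon>)"
proof (cases "D \<le> \<delta> * R \<or> D \<le> \<epsilon>")
  case True
  have L: "1 \<le> 60 / \<delta>" using \<delta> by (simp add: le_divide_eq)
  have "0 \<le> \<delta> * R" using \<delta> set_set_dist_nonneg[OF p(1,2), of X] by simp
  then show ?thesis using True gauge_nonneg[OF L order_refl] eps_nonneg by linarith
next
  case False
  then have D: "\<delta> * R < D" "\<epsilon> < D" by auto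
  note tri = mdist_triangle[of _ X]
  \<comment> \<open>Chosen so that \<open>L * (D / 6) = 10 * (D / \<delta>)\<close> exceeds the
    length of the whole walk, see \<open>len\<close>.\<close>
  define L where "L = 60 / \<delta>"
  have L: "6 \<le> L" using \<delta> by (simp add: L_def le_divide_eq)
  obtain \<eta> where \<eta>: "geod X (mdist X p p') \<eta>" "\<eta> 0 = p" "\<eta> (mdist X p p') = p'"
    using geodesic_space_geod[OF geodesic points(1,2)] .
  obtain \<kappa> where \<kappa>: "geod X (mdist X y x) \<kappa>" "\<kappa> 0 = y" "\<kappa> (mdist X y x) = x"
    using geodesic_space_geod[OF geodesic points(4,3)] .
  define a0 b0 where "a0 = mdist X p p'" and "b0 = mdist X y x"
  note \<eta> = \<eta>[folded a0_def] and \<kappa> = \<kappa>[folded b0_def]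
  let ?box = "{0..a0} \<times> {0..b0}"
  let ?F = "\<lambda>z. (case z of (s, t) \<Rightarrow> mdist X (\<eta> s) (\<kappa> t)) - (fst z + snd z + D) / 6"
  \<comment> \<open>The close pairs form a compact set, so the parameter sum attains its minimum on
    it. Every pair with a smaller sum is then far apart.\<close>
  define S where "S = ?box \<inter> ?F -` {..0}"
  have S: "(s, t) \<in> S \<longleftrightarrow> 0 \<le> s \<and> s \<le> a0 \<and> 0 \<le> t \<and> t \<le> b0 \<and>
      mdist X (\<eta> s) (\<kappa> t) \<le> (s + t + D) / 6" for s t
    by (auto simp: S_def)
  have "S \<noteq> {}" using close_points_exist[OF \<eta> \<kappa> R] S by (metis empty_iff)
  moreover have "compact S"
  proof -
    have "continuous_on ?box ?F"
      by (intro continuous_intros geods_mdist_continuous[OF \<eta>(1) \<kappa>(1)]) auto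
    then have "closed S" unfolding S_def
      by (intro continuous_closed_preimage closed_Times) auto
    moreover have "S = ?box \<inter> S" by (auto simp: S_def)
    ultimately show ?thesis
      using compact_Int_closed[of ?box S] by (simp add: compact_Times)
  qed
  ultimately have "\<exists>z\<in>S. \<forall>w\<in>S. fst z + snd z \<le> fst w + snd w"
    by (intro continuous_attains_inf continuous_intros)
  then obtain a b where ab: "(a, b) \<in> S"
    and min: "\<And>s t. (s, t) \<in> S \<Longrightarrow> a + b \<le> s + t" by fastforce
  have a: "0 \<le> a" "a \<le> a0" and b: "0 \<le> b" "b \<le> b0" using ab S by auto
  define k where "k = mdist X (\<eta> a) (\<kappa> b)"
  have k: "0 \<le> k" "k \<le> (a + b + D) / 6" using ab S by (auto simp: k_def)
  have apart: "(s + t + D) / 6 \<le> mdist X (\<eta> s) (\<kappa> t)"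
    if "0 \<le> s" "s \<le> a" "0 \<le> t" "t \<le> b" "s + t < a + b" for s t
    using min[of s t] S[of s t] a b that by linarith
  have M\<eta>: "\<eta> t \<in> mspace X" if "0 \<le> t" "t \<le> a" for t
    using qpath_mspace[OF \<eta>(1)] that a by simp
  have M\<kappa>: "\<kappa> t \<in> mspace X" if "0 \<le> t" "t \<le> b" for t
    using qpath_mspace[OF \<kappa>(1)] that b by simp
  have M: "\<eta> a \<in> mspace X" "\<kappa> b \<in> mspace X" using M\<eta> M\<kappa> a b by auto
  have d\<eta>: "mdist X (\<eta> s) (\<eta> t) = \<bar>s - t\<bar>" if "0 \<le> s" "s \<le> a" "0 \<le> t" "t \<le> a" for s t
    using geod_mdist[OF \<eta>(1)] a that by simp
  have d\<kappa>: "mdist X (\<kappa> s) (\<kappa> t) = \<bar>s - t\<bar>" if "0 \<le> s" "s \<le> b" "0 \<le> t" "t \<le> b" for s t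
    using geod_mdist[OF \<kappa>(1)] b that by simp
  have a_far: "a \<le> point_set_dist X (\<eta> a) Y + \<epsilon>" using side_far[OF \<eta> a] .

  \<comment> \<open>Going from \<open>\<kappa> b\<close> to \<open>p\<close> bounds \<open>b\<close>
    by \<open>a\<close>, so everything is controlled by \<open>a \<le> R + \<epsilon>\<close> and
    \<open>D\<close>.\<close>
  have "b \<le> point_set_dist X (\<kappa> b) Y + \<epsilon>" using side_far'[OF \<kappa> b] .
  also have "point_set_dist X (\<kappa> b) Y \<le> mdist X (\<kappa> b) p"
    using p(1) by (rule point_set_dist_le)
  also have "\<dots> \<le> k + a"
    using tri[of "\<kappa> b" "\<eta> a" p] M points d\<eta>[of a 0] \<eta> a mdist_commute[of X "\<kappa> b" "\<eta> a"]
    by (simp add: k_def)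
  finally have b_le: "b \<le> a + k + \<epsilon>" by simp
  have D_le: "D \<le> a + k + b"
    using tri[of p "\<eta> a" y] tri[of "\<eta> a" "\<kappa> b" y] M points d\<eta>[of 0 a] d\<kappa>[of b 0] \<eta> \<kappa> a b
    by (simp add: k_def)
  have len: "a + k + b \<le> L * (D / 6)"
  proof -
    have "a \<le> R + \<epsilon>" using a p(3) by (simp add: a0_def)
    moreover have "R < D / \<delta>" using D \<delta> by (simp add: less_divide_eq mult.commute)
    moreover have "D \<le> D / \<delta>" using \<delta> by (simp add: le_divide_eq mult_left_le)
    moreover have "L * (D / 6) = 10 * (D / \<delta>)" by (simp add: L_def)
    ultimately show ?thesis using b_le k D eps_nonneg by argo
  qed

  obtain \<omega> where \<omega>: "geod X k \<omega>" "\<omega> 0 = \<eta> a" "\<omega> k = \<kappa> b"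
    using geodesic_space_geod[OF geodesic M] unfolding k_def .
  have M\<omega>: "\<omega> t \<in> mspace X" if "0 \<le> t" "t \<le> k" for t using qpath_mspace[OF \<omega>(1)] that .
  let ?\<kappa> = "\<lambda>t. \<kappa> (b - t)"
  have g: "qpath X L 0 a \<eta>" "qpath X L 0 k \<omega>" "qpath X L 0 b ?\<kappa>"
    using geod_sub[OF \<eta>(1), of 0 a] geod_reverse[OF geod_sub[OF \<kappa>(1), of 0 b]] \<omega>(1) a b L
    by (auto intro!: geod_mono)
  have weaken: "v / L - 0 \<le> d" if "0 \<le> v" "v / 6 \<le> d" for v d
    using frac_le[OF that(1) order_refl _ L] that(2) by linarith
  have c12: "(a - s + t) / L - 0 \<le> mdist X (\<eta> s) (\<omega> t)"
    if "0 \<le> s" "s \<le> a" "0 \<le> t" "t \<le> k" for s t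
  proof (rule weaken)
    show "0 \<le> a - s + t" using that by simp
    \<comment> \<open>The pair \<open>(a, b)\<close> is close and earlier pairs are not, so moving
      back by \<open>a - s\<close> shortens the distance by at most a sixth of that. This replaces
      exact minimality of the connection \<open>\<omega>\<close>.\<close>
    have "k - (a - s) / 6 \<le> mdist X (\<eta> s) (\<kappa> b)"
      using apart[of s b] k that b by (cases "s = a") (auto simp: k_def field_simps)
    moreover have "mdist X (\<eta> s) (\<kappa> b) \<le> mdist X (\<eta> s) (\<omega> t) + (k - t)"
      "a - s \<le> mdist X (\<eta> s) (\<omega> t) + t"
      using tri[of "\<eta> s" "\<omega> t" "\<kappa> b"] tri[of "\<eta> s" "\<omega> t" "\<eta> a"]
        d\<eta>[of s a] geod_mdist[OF \<omega>(1), of t k] geod_mdist[OF \<omega>(1), of t 0] \<omega>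
        M\<eta>[of s] M\<omega>[of t] M that a k(1) by simp_all
    ultimately show "(a - s + t) / 6 \<le> mdist X (\<eta> s) (\<omega> t)" using that by argo
  qed
  have c23: "(k - s + t) / L - 0 \<le> mdist X (\<omega> s) (?\<kappa> t)"
    if "0 \<le> s" "s \<le> k" "0 \<le> t" "t \<le> b" for s t
  proof (rule weaken)
    show "0 \<le> k - s + t" using that by simp
    have "k - t / 6 \<le> mdist X (\<eta> a) (\<kappa> (b - t))"
      using apart[of a "b - t"] k that a by (cases "t = 0") (auto simp: k_def field_simps)
    moreover have "mdist X (\<eta> a) (\<kappa> (b - t)) \<le> s + mdist X (\<omega> s) (\<kappa> (b - t))"
      "t \<le> (k - s) + mdist X (\<omega> s) (\<kappa> (b - t))"
      using tri[of "\<eta> a" "\<omega> s" "\<kappa> (b - t)"] tri[of "\<kappa> b" "\<omega> s" "\<kappa> (b - t)"]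
        d\<kappa>[of b "b - t"] geod_mdist[OF \<omega>(1), of 0 s] geod_mdist[OF \<omega>(1), of k s] \<omega>
        M\<kappa>[of "b - t"] M\<omega>[of s] M that b k(1) by simp_all
    ultimately show "(k - s + t) / 6 \<le> mdist X (\<omega> s) (?\<kappa> t)" using that by argo
  qed
  \<comment> \<open>The outer sides stay \<open>D / 6\<close> apart while the whole walk is no
    longer than \<open>L * (D / 6)\<close>. Only the pair \<open>(a, b)\<close> itself escapes
    \<open>apart\<close>; it is the pair of ends of \<open>\<omega>\<close>.\<close>
  have c13: "(a - s + k + t) / L \<le> mdist X (\<eta> s) (?\<kappa> t)"
    if "0 \<le> s" "s \<le> a" "0 \<le> t" "t \<le> b" for s t
  proof (cases "s = a \<and> t = 0")
    case True
    then show ?thesis using c12[of a k] a k \<omega> by simp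
  next
    case False
    then have "(s + (b - t) + D) / 6 \<le> mdist X (\<eta> s) (?\<kappa> t)"
      using that by (intro apart) auto
    then have "D / 6 \<le> mdist X (\<eta> s) (?\<kappa> t)" using that by simp
    moreover have "(a - s + k + t) / L \<le> D / 6"
      using len L that by (simp add: divide_le_eq mult.commute)
    ultimately show ?thesis by linarith
  qed
  let ?l = "join a \<eta> \<omega>"
  let ?\<gamma> = "join (a + k) ?l ?\<kappa>"
  have l: "qpath X L 0 (a + k) ?l" by (rule qpath_join[OF g(1,2)]) (use \<omega> c12 in auto)
  have eq: "?l (a + k) = ?\<kappa> 0" using join_end[of k \<eta> a \<omega>] k \<omega> by simp
  have "qpath X L 0 (a + k + b) ?\<gamma>"
  proof (rule qpath_join[OF l g(3) eq])
    fix s t assume st: "0 \<le> s" "s \<le> a + k" "0 \<le> t" "t \<le> b"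
    show "(a + k - s + t) / L - 0 \<le> mdist X (?l s) (?\<kappa> t)"
      using c13[of s t] c23[of "s - a" t] st by (auto simp: join_def algebra_simps)
  qed
  moreover have "?\<gamma> 0 = p" using a k \<eta> by (simp add: join_def)
  moreover have "?\<gamma> (a + k + b) = y"
    using join_end[of b ?l "a + k" ?\<kappa>, OF b(1) eq] \<kappa> by simp
  moreover have "?\<gamma> a = \<eta> a" using k by (simp add: join_def)
  ultimately have "point_set_dist X (\<eta> a) Y \<le> \<mu> L 0"
    using Morse_qpath[OF Morse(1), of L 0 "a + k + b" ?\<gamma> a] p y a b k L by simp
  \<comment> \<open>Now \<open>a \<le> \<mu> L 0 + \<epsilon>\<close>. Eliminating \<open>b\<close>
    and \<open>D\<close> from the bound on \<open>k\<close> gives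
    \<open>k \<le> (4 * a + 2 * \<epsilon>) / 3\<close>, which bounds \<open>D\<close> by a multiple
    of \<open>a\<close> and \<open>\<epsilon>\<close>.\<close>
  then have "D \<le> 5 * \<mu> L 0 + 8 * \<epsilon>"
    using a_far b_le D_le k eps_nonneg gauge_nonneg[of L 0] L by argo
  moreover have "0 \<le> \<delta> * R" using \<delta> set_set_dist_nonneg[OF p(1,2), of X] by simp
  ultimately show ?thesis by (simp add: L_def)
qed

end

section \<open>Sublinear functions as infima of affine functions\<close>

text \<open>Each \<open>\<delta>\<close> bounds the infimum by a line of slope
  \<open>\<delta>\<close>, so no positive growth rate survives. Nonnegativity of \<open>N\<close>
  keeps the infimum bounded below.\<close>

lemma sublinear_INF:
  assumes N: "\<And>\<delta>. 0 < \<delta> \<Longrightarrow> \<delta> \<le> 1 \<Longrightarrow> 0 \<le> N \<delta>"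
  shows "sublinear (\<lambda>r. INF \<delta>\<in>{0<..1::real}. \<delta> * r + N \<delta>)"
proof -
  let ?f = "\<lambda>r. INF \<delta>\<in>{0<..1::real}. \<delta> * r + N \<delta>"
  have bdd: "bdd_below ((\<lambda>\<delta>. \<delta> * r + N \<delta>) ` {0<..1})" if "0 \<le> r" for r
    using that N by (intro bdd_belowI[of _ 0]) auto
  have nonneg: "0 \<le> ?f r" if "0 \<le> r" for r
    using that N by (intro cINF_greatest) auto
  have upper: "?f r \<le> \<delta> * r + N \<delta>" if "0 \<le> r" "0 < \<delta>" "\<delta> \<le> 1" for r \<delta>
    using that by (intro cINF_lower bdd) auto
  have "mono_on {0..} ?f"
  proof (rule mono_onI)
    fix r r' :: real assume r: "r \<in> {0..}" "r' \<in> {0..}" "r \<le> r'"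
    show "?f r \<le> ?f r'"
    proof (rule cINF_mono)
      show "\<exists>\<delta>'\<in>{0<..1}. \<delta>' * r + N \<delta>' \<le> \<delta> * r' + N \<delta>" if "\<delta> \<in> {0<..1}" for \<delta>
        using that r by (intro bexI[of _ \<delta>]) (auto intro: mult_left_mono)
    qed (use bdd r in auto)
  qed
  moreover have "\<forall>\<^sub>F r in at_top. 0 \<le> ?f r"
    using eventually_ge_at_top[of 0] by eventually_elim (rule nonneg)
  moreover have "((\<lambda>r. ?f r / r) \<longlongrightarrow> 0) at_top"
  proof (rule tendstoI)
    fix e :: real assume e: "0 < e"
    \<comment> \<open>Half of \<open>e\<close> pays for the slope, the other half for
      \<open>N \<delta> / r\<close> at large \<open>r\<close>.\<close>
    define \<delta> where "\<delta> = min 1 (e / 2)"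
    have \<delta>: "0 < \<delta>" "\<delta> \<le> 1" "\<delta> \<le> e / 2" using e by (auto simp: \<delta>_def)
    show "\<forall>\<^sub>F r in at_top. dist (?f r / r) 0 < e"
      using eventually_gt_at_top[of "max 0 (2 * N \<delta> / e)"]
    proof eventually_elim
      case (elim r)
      then have r: "0 < r" "N \<delta> < e / 2 * r" using e by (auto simp: field_simps)
      have "\<delta> * r \<le> e / 2 * r" using \<delta> r by (intro mult_right_mono) auto
      then have "?f r < e * r" using upper[of r \<delta>] \<delta> r by linarith
      then show ?case using nonneg[of r] r by (simp add: dist_real_def divide_less_eq)
    qed
  qed
  ultimately show ?thesis by (simp add: sublinear_def)
qed

lemma sublinear_cmult:
  assumes "0 \<le> c" "sublinear f"
  shows "sublinear (\<lambda>r. c * f r)"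
proof -
  have "((\<lambda>r. c * (f r / r)) \<longlongrightarrow> c * 0) at_top"
    using assms unfolding sublinear_def by (intro tendsto_mult_left) auto
  moreover have "mono_on {0..} (\<lambda>r. c * f r)"
    using assms unfolding sublinear_def by (auto simp: mono_on_def intro: mult_left_mono)
  moreover have "\<forall>\<^sub>F r in at_top. 0 \<le> c * f r"
    using assms unfolding sublinear_def by (auto elim: eventually_mono)
  ultimately show ?thesis by (simp add: sublinear_def)
qed

section \<open>The diameter of the projection\<close>

theorem proposition8p2:
  fixes \<mu> :: "real \<Rightarrow> real \<Rightarrow> real" and \<epsilon> :: real
  assumes "\<And>L A. 1 \<le> L \<Longrightarrow> 0 \<le> A \<Longrightarrow> 0 \<le> \<mu> L A"
    and "0 \<le> \<epsilon>"
  shows "\<exists>\<rho> :: real \<Rightarrow> real. sublinear \<rho> \<and>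
    (\<forall>(X :: 'a metric) Y Y'.
       geodesic_space X \<longrightarrow>
       Morse_subspace X \<mu> Y \<longrightarrow>
       Morse_subspace X \<mu> Y' \<longrightarrow>
       {} \<notin> closest_proj X \<epsilon> Y ` mspace X \<longrightarrow>
       (\<exists>p\<in>Y. \<exists>p'\<in>Y'. mdist X p p' \<le> set_set_dist X Y Y' + \<epsilon>) \<longrightarrow>
       set_set_dist X Y Y' > 2 * \<mu> 6 0 \<longrightarrow>
       mdiam X (closest_proj_set X \<epsilon> Y Y') \<le> ereal (\<rho> (set_set_dist X Y Y')))"
proof -
  define A where "A = \<epsilon> + \<mu> 6 0"
  define B where "B = 9 * (\<mu> 6 A + \<epsilon>) + 15 * A"
  \<comment> \<open>Adding \<open>B\<close> covers the range \<open>R \<le> \<mu> 6 A\<close>, where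
    \<open>rough_bound\<close> bounds the distance by a constant. Only \<open>\<mu>\<close> and
    \<open>\<epsilon>\<close> enter, so one function serves all spaces.\<close>
  define N where "N \<delta> = B + (5 * \<mu> (60 / \<delta>) 0 + 8 * \<epsilon>)" for \<delta>
  have A: "0 \<le> A" using assms(1)[of 6 0] assms(2) by (simp add: A_def)
  have B: "0 \<le> B" using A assms(1)[of 6 A] assms(2) by (simp add: B_def)
  have \<mu>: "0 \<le> \<mu> (60 / \<delta>) 0" if "0 < \<delta>" "\<delta> \<le> 1" for \<delta>
    using that by (intro assms(1)) (auto simp: le_divide_eq)
  define f where "f r = (INF \<delta>\<in>{0<..1::real}. \<delta> * r + N \<delta>)" for r
  \<comment> \<open>The factor 2 comes from comparing two projected points through
    \<open>p\<close>.\<close>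
  have "sublinear (\<lambda>r. 2 * f r)"
    unfolding f_def using B \<mu> assms(2)
    by (intro sublinear_cmult sublinear_INF) (auto simp: N_def)
  moreover have "mdiam X (closest_proj_set X \<epsilon> Y Y') \<le> ereal (2 * f (set_set_dist X Y Y'))"
    if "geodesic_space X" "Morse_subspace X \<mu> Y" "Morse_subspace X \<mu> Y'"
      and p: "p \<in> Y" "p' \<in> Y'" "mdist X p p' \<le> set_set_dist X Y Y' + \<epsilon>"
      and R: "set_set_dist X Y Y' > 2 * \<mu> 6 0"
    for X :: "'a metric" and Y Y' p p'
  proof -
    have le: "mdist X p y \<le> f (set_set_dist X Y Y')" and y_mem: "y \<in> mspace X" "p \<in> mspace X"
      if "y \<in> closest_proj_set X \<epsilon> Y Y'" for y
    proof -
      obtain x where "x \<in> Y'" "y \<in> closest_proj X \<epsilon> Y x"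
        using \<open>y \<in> closest_proj_set X \<epsilon> Y Y'\<close> by (auto simp: closest_proj_set_def)
      then interpret Morse_pair X \<mu> \<epsilon> Y Y' p p' x y
        using \<open>geodesic_space X\<close> \<open>Morse_subspace X \<mu> Y\<close> \<open>Morse_subspace X \<mu> Y'\<close> p assms
        by unfold_locales
      show "y \<in> mspace X" "p \<in> mspace X" by (fact points)+
      have "mdist X p y \<le> \<delta> * set_set_dist X Y Y' + N \<delta>" if \<delta>: "0 < \<delta>" "\<delta> \<le> 1" for \<delta>
      proof (cases "\<mu> 6 A < set_set_dist X Y Y'")
        case True
        then show ?thesis
          using sublinear_bound[of \<delta>] \<delta> B by (simp add: N_def A_def)
      next
        case False
        have "0 \<le> \<delta> * set_set_dist X Y Y'"
          using \<delta> set_set_dist_nonneg[OF p(1,2), of X] by simp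
        then show ?thesis
          using rough_bound[OF R] False \<mu>[OF \<delta>] assms(2) by (simp add: N_def B_def A_def)
      qed
      then show "mdist X p y \<le> f (set_set_dist X Y Y')"
        unfolding f_def by (intro cINF_greatest) auto
    qed
    show ?thesis
      unfolding mdiam_def
    proof (intro SUP_least)
      fix u v assume uv: "u \<in> closest_proj_set X \<epsilon> Y Y'" "v \<in> closest_proj_set X \<epsilon> Y Y'"
      show "ereal (mdist X u v) \<le> ereal (2 * f (set_set_dist X Y Y'))"
        using mdist_triangle[of u X p v] le[OF uv(1)] le[OF uv(2)] y_mem[OF uv(1)] y_mem[OF uv(2)]
          mdist_commute[of X u p] by simp
    qed
  qed
  ultimately show ?thesis by blast
qed

end
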